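(* (Soundness of access Hoare logic.) For every program $C$ of the while language and all assertions $P,Q$: if $\langle P\rangle\,C\,\langle Q\rangle$ is provable in access Hoare logic, then $\langle P\rangle\,C\,\langle Q\rangle$ is valid.
   Context: States are mappings from variables to values; assertions are predicates on states. Programs of the while language are built from $\mathtt{skip}$, assignments $V:=E$ ($V$ a variable, $E$ a side-effect-free expression possibly containing $V$), sequential composition $S;T$, $\mathtt{if}\ B\ \mathtt{then}\ S\ \mathtt{else}\ T$ and $\mathtt{while}\ B\ \mathtt{do}\ S$ ($B$ a boolean condition), with the standard deterministic big-step execution relation $C:s\Rightarrow s'$. The access Hoare triple $\langle P\rangle\,C\,\langle Q\rangle$ is valid iff $\forall s,s'\,[\,C:s\Rightarrow s'\wedge Q(s')\rightarrow P(s)\,]$. Access Hoare logic is the calculus with the following axioms and rules: (skip) $\langle P\rangle\,\mathtt{skip}\,\langle P\rangle$; (assignment) $\langle P[E/V]\rangle\,V:=E\,\langle P\rangle$, where $P[E/V]$ replaces free occurrences of $V$ in $P$ by $E$; (consequence) from $P_2\rightarrow P_1$ (valid implication), $\langle P_2\rangle\,S\,\langle Q_2\rangle$ and $Q_1\rightarrow Q_2$ (valid implication) infer $\langle P_1\rangle\,S\,\langle Q_1\rangle$; (composition) from $\langle P\rangle\,S\,\langle R\rangle$ and $\langle R\rangle\,T\,\langle Q\rangle$ infer $\langle P\rangle\,S;T\,\langle Q\rangle$; (conditional) from $\langle B\rightarrow P\rangle\,S\,\langle Q\rangle$ and $\langle \neg B\rightarrow P\rangle\,T\,\langle Q\rangle$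 infer $\langle P\rangle\,\mathtt{if}\ B\ \mathtt{then}\ S\ \mathtt{else}\ T\,\langle Q\rangle$; (while) from $\langle B\rightarrow P\rangle\,S\,\langle P\rangle$ infer $\langle P\rangle\,\mathtt{while}\ B\ \mathtt{do}\ S\,\langle \neg B\rightarrow P\rangle$. *)

theory Defs
  imports Main
begin

type_synonym ('v, 'a) state = "'v \<Rightarrow> 'a"
type_synonym ('v, 'a) assn = "('v, 'a) state \<Rightarrow> bool"

text \<open>Expressions and conditions are represented by their denotations; evaluation cannot
  change the state, so they are side-effect free. The types of variables and values are arbitrary.\<close>

type_synonym ('v, 'a) expr = "('v, 'a) state \<Rightarrow> 'a"
type_synonym ('v, 'a) bexpr = "('v, 'a) state \<Rightarrow> bool"

datatype ('v, 'a) com =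
    SKIP
  | Assign 'v "('v, 'a) expr"  (\<open>_ ::= _\<close> [1000, 61] 61)
  | Seq "('v, 'a) com" "('v, 'a) com"  (\<open>_;;/ _\<close> [60, 61] 60)
  | If "('v, 'a) bexpr" "('v, 'a) com" "('v, 'a) com"
      (\<open>(IF _/ THEN _/ ELSE _)\<close> [0, 0, 61] 61)
  | While "('v, 'a) bexpr" "('v, 'a) com"  (\<open>(WHILE _/ DO _)\<close> [0, 61] 61)

inductive big_step :: "('v, 'a) com \<Rightarrow> ('v, 'a) state \<Rightarrow> ('v, 'a) state \<Rightarrow> bool"
where
  Skip: "big_step SKIP s s"
| Assign: "big_step (V ::= E) s (s(V := E s))"
| Seq: "\<lbrakk>big_step S s t; big_step T t u\<rbrakk> \<Longrightarrow> big_step (S ;; T) s u"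
| IfTrue: "\<lbrakk>B s; big_step S s t\<rbrakk> \<Longrightarrow> big_step (IF B THEN S ELSE T) s t"
| IfFalse: "\<lbrakk>\<not> B s; big_step T s t\<rbrakk> \<Longrightarrow> big_step (IF B THEN S ELSE T) s t"
| WhileFalse: "\<not> B s \<Longrightarrow> big_step (WHILE B DO S) s s"
| WhileTrue: "\<lbrakk>B s; big_step S s t; big_step (WHILE B DO S) t u\<rbrakk>
    \<Longrightarrow> big_step (WHILE B DO S) s u"

definition access_valid :: "('v, 'a) assn \<Rightarrow> ('v, 'a) com \<Rightarrow> ('v, 'a) assn \<Rightarrow> bool"
where
  "access_valid P C Q \<longleftrightarrow> (\<forall>s s'. big_step C s s' \<and> Q s' \<longrightarrow> P s)"

text \<open>Substitution of \<open>E\<close> for \<open>V\<close> in a predicate on states: evaluate the predicate in the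
  state where \<open>V\<close> holds the value of \<open>E\<close>.\<close>

definition assn_subst :: "('v, 'a) assn \<Rightarrow> ('v, 'a) expr \<Rightarrow> 'v \<Rightarrow> ('v, 'a) assn"
where
  "assn_subst P E V = (\<lambda>s. P (s(V := E s)))"

inductive access_provable :: "('v, 'a) assn \<Rightarrow> ('v, 'a) com \<Rightarrow> ('v, 'a) assn \<Rightarrow> bool"
where
  Skip: "access_provable P SKIP P"
| Assign: "access_provable (assn_subst P E V) (V ::= E) P"
| Conseq: "\<lbrakk>\<forall>s. P2 s \<longrightarrow> P1 s; access_provable P2 S Q2; \<forall>s. Q1 s \<longrightarrow> Q2 s\<rbrakk>
    \<Longrightarrow> access_provable P1 S Q1"
| Seq: "\<lbrakk>access_provable P S R; access_provable R T Q\<rbrakk> \<Longrightarrow> access_provable P (S ;; T) Q"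
| If: "\<lbrakk>access_provable (\<lambda>s. B s \<longrightarrow> P s) S Q; access_provable (\<lambda>s. \<not> B s \<longrightarrow> P s) T Q\<rbrakk>
    \<Longrightarrow> access_provable P (IF B THEN S ELSE T) Q"
| While: "access_provable (\<lambda>s. B s \<longrightarrow> P s) S P
    \<Longrightarrow> access_provable P (WHILE B DO S) (\<lambda>s. \<not> B s \<longrightarrow> P s)"

end

theory Submission
  imports Defs
begin

text \<open>A valid access triple transports truth backwards, from the final state of an execution
  to its initial state. The assertion of the while rule is therefore an invariant read from the
  exit of the loop to its entry: the body only gives \<open>B \<longrightarrow> P\<close> before each pass, which
  is \<open>P\<close> because a pass is made only when \<open>B\<close> holds.\<close>

inductive_cases big_step_SkipE: "big_step SKIP s t"
inductive_cases big_step_AssignE: "big_step (V ::= E) s t"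
inductive_cases big_step_SeqE: "big_step (S ;; T) s u"
inductive_cases big_step_IfE: "big_step (IF B THEN S ELSE T) s t"

lemma access_validI:
  assumes "\<And>s t. \<lbrakk>big_step C s t; Q t\<rbrakk> \<Longrightarrow> P s"
  shows "access_valid P C Q"
  using assms by (auto simp: access_valid_def)

lemma access_validD:
  assumes "access_valid P C Q" "big_step C s t" "Q t"
  shows "P s"
  using assms by (auto simp: access_valid_def)

lemma access_valid_Skip: "access_valid P SKIP P"
  by (rule access_validI) (auto elim: big_step_SkipE)

lemma access_valid_Assign: "access_valid (assn_subst P E V) (V ::= E) P"
  by (rule access_validI) (auto simp: assn_subst_def elim: big_step_AssignE)

lemma access_valid_Conseq:
  assumes "\<forall>s. P2 s \<longrightarrow> P1 s" "access_valid P2 S Q2" "\<forall>s. Q1 s \<longrightarrow> Q2 s"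
  shows "access_valid P1 S Q1"
  using assms by (blast intro: access_validI dest: access_validD)

lemma access_valid_Seq:
  assumes "access_valid P S R" "access_valid R T Q"
  shows "access_valid P (S ;; T) Q"
proof (rule access_validI)
  fix s u
  assume "big_step (S ;; T) s u" "Q u"
  then obtain t where "big_step S s t" "big_step T t u"
    by (elim big_step_SeqE)
  from assms(2) \<open>big_step T t u\<close> \<open>Q u\<close> have "R t"
    by (rule access_validD)
  with assms(1) \<open>big_step S s t\<close> show "P s"
    by (rule access_validD)
qed

lemma access_valid_If:
  assumes "access_valid (\<lambda>s. B s \<longrightarrow> P s) S Q" "access_valid (\<lambda>s. \<not> B s \<longrightarrow> P s) T Q"
  shows "access_valid P (IF B THEN S ELSE T) Q"
proof (rule access_validI)
  fix s t
  assume "big_step (IF B THEN S ELSE T) s t" "Q t"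
  then show "P s"
    using assms by (blast elim: big_step_IfE dest: access_validD)
qed

lemma big_step_While_exit:
  assumes "big_step (WHILE B DO S) s t"
  shows "\<not> B t"
  using assms by (induction "WHILE B DO S" s t rule: big_step.induct) auto

lemma big_step_While_backward_invariant:
  assumes body: "access_valid (\<lambda>s. B s \<longrightarrow> P s) S P"
    and "big_step (WHILE B DO S) s t" "P t"
  shows "P s"
  using assms(2,3)
proof (induction "WHILE B DO S" s t rule: big_step.induct)
  case (WhileFalse s)
  then show ?case by simp
next
  case (WhileTrue s t u)
  then have "P t" by simp
  with body \<open>big_step S s t\<close> have "B s \<longrightarrow> P s"
    by (rule access_validD)
  with \<open>B s\<close> show ?case by simp
qed

lemma access_valid_While:
  assumes "access_valid (\<lambda>s. B s \<longrightarrow> P s) S P"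
  shows "access_valid P (WHILE B DO S) (\<lambda>s. \<not> B s \<longrightarrow> P s)"
proof (rule access_validI)
  fix s t
  assume loop: "big_step (WHILE B DO S) s t" and "\<not> B t \<longrightarrow> P t"
  with big_step_While_exit have "P t" by blast
  with assms loop show "P s"
    by (rule big_step_While_backward_invariant)
qed

theorem theorem6p1:
  fixes C :: "('v, 'a) com" and P Q :: "('v, 'a) assn"
  assumes "access_provable P C Q"
  shows "access_valid P C Q"
  using assms
proof (induction rule: access_provable.induct)
  case Skip
  show ?case by (rule access_valid_Skip)
next
  case Assign
  show ?case by (rule access_valid_Assign)
next
  case Conseq
  then show ?case by (blast intro: access_valid_Conseq)
next
  case Seq
  then show ?case by (blast intro: access_valid_Seq)
next
  case If
  then show ?case by (blast intro: access_valid_If)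
next
  case While
  then show ?case by (blast intro: access_valid_While)
qed

end
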